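(* Let $\mathcal{X}$ be a finite set, let $\pi$ be a probability measure on $\mathcal{X}$ with strictly positive masses, let $P\in\mathcal{L}(\pi)$, and let $\mathcal{X}=\bigsqcup_{i=1}^k\mathcal{O}_i$ be a partition into $k\ge2$ non-empty sets, with associated Gibbs kernel $G$ and projection chain $\overline{P}$. Then for every $l\in\mathbb{N}$ with $l\ge2$, $$D_{\mathrm{KL}}^\pi\left((PG)^l\,\|\,\Pi\right)\le\left(1-\alpha\left(\overline{P}^2\right)\right)^{l-1}H(\overline{\pi}).$$
   Context: $\mathcal{L}(\pi)$ is the set of $\pi$-reversible transition matrices on $\mathcal{X}$. The Gibbs kernel is $G(x,y)=\pi(y)/\pi(\mathcal{O}(x))$ if $y\in\mathcal{O}(x)$ and $0$ otherwise, where $\mathcal{O}(x)$ is the block containing $x$ and $\pi(A)=\sum_{z\in A}\pi(z)$. $\Pi$ is the matrix all of whose rows equal $\pi$. The projection chain is the $k\times k$ transition matrix $\overline{P}(i,j)=\frac{1}{\pi(\mathcal{O}_i)}\sum_{x\in\mathcal{O}_i,\,y\in\mathcal{O}_j}\pi(x)P(x,y)$, with stationary distribution $\overline{\pi}=(\pi(\mathcal{O}_1),\dots,\pi(\mathcal{O}_k))$; $\overline{P}^2=\overline{P}\,\overline{P}$. $D^\pi_{\mathrm{KL}}(A\|B)=\sum_{x,y}\pi(x)A(x,y)\log\frac{A(x,y)}{B(x,y)}$, with $0\log(0/a)=0$. Shannon entropy: $H(\mu)=-\sum_x\mu(x)\log\mu(x)$. The log-Sobolev constant of a $\mu$-stationary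 transition matrix $Q$ is $\alpha(Q)=\inf\{\langle(I-Q)f,f\rangle_\mu/\mathscr{L}(f): f\text{ real-valued},\ \mathscr{L}(f)\neq0\}$, where $\mathscr{L}(f)=\sum_x|f(x)|^2\log(|f(x)|^2/\|f\|_\mu^2)\mu(x)$, $\langle f,g\rangle_\mu=\sum_xf(x)g(x)\mu(x)$ and $\|f\|_\mu^2=\langle f,f\rangle_\mu$ (for $\alpha(\overline{P}^2)$, take $\mu=\overline{\pi}$). *)

theory Defs
  imports "HOL-Analysis.Analysis"
begin

text \<open>
  A finite set with \<open>n\<close> elements is a type of class \<open>finite\<close>; measures and real functions on it
  are vectors \<open>real ^ 'x\<close>, kernels are matrices \<open>real ^ 'x ^ 'x\<close> with \<open>A $ x $ y\<close> the entry
  \<open>A(x,y)\<close>. A partition into \<open>k\<close> blocks is a family indexed by a finite type with \<open>k\<close> elements.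
\<close>

definition prob_vector :: "real ^ 'x \<Rightarrow> bool" where
  "prob_vector \<mu> \<longleftrightarrow> (\<forall>x. 0 \<le> \<mu> $ x) \<and> (\<Sum>x\<in>UNIV. \<mu> $ x) = 1"

definition transition_matrix :: "real ^ 'x ^ 'x \<Rightarrow> bool" where
  "transition_matrix P \<longleftrightarrow> (\<forall>x. prob_vector (P $ x))"

definition reversible_matrices :: "real ^ 'x \<Rightarrow> (real ^ 'x ^ 'x) set" where
  "reversible_matrices \<mu> =
     {P. transition_matrix P \<and> (\<forall>x y. \<mu> $ x * P $ x $ y = \<mu> $ y * P $ y $ x)}"

text \<open>The operations \<open>*\<close> and \<open>^\<close> on type \<open>vec\<close> act entrywise, so powers with respect to
  the matrix product are defined here.\<close>

primrec matrix_power :: "real ^ 'x ^ 'x \<Rightarrow> nat \<Rightarrow> real ^ 'x ^ 'x" where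
  "matrix_power A 0 = mat 1"
| "matrix_power A (Suc n) = A ** matrix_power A n"

definition mass :: "real ^ 'x \<Rightarrow> 'x set \<Rightarrow> real" where
  "mass \<mu> A = (\<Sum>z\<in>A. \<mu> $ z)"

definition is_partition :: "('k \<Rightarrow> 'x set) \<Rightarrow> bool" where
  "is_partition B \<longleftrightarrow> (\<forall>i. B i \<noteq> {}) \<and> disjoint_family B \<and> (\<Union>i. B i) = UNIV"

definition block :: "('k \<Rightarrow> 'x set) \<Rightarrow> 'x \<Rightarrow> 'x set" where
  "block B x = B (THE i. x \<in> B i)"

definition gibbs_kernel :: "real ^ 'x \<Rightarrow> ('k \<Rightarrow> 'x set) \<Rightarrow> real ^ 'x ^ 'x" where
  "gibbs_kernel \<mu> B =
     (\<chi> x y. if y \<in> block B x then \<mu> $ y / mass \<mu> (block B x) else 0)"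

definition stationary_matrix :: "real ^ 'x \<Rightarrow> real ^ 'x ^ 'x" where
  "stationary_matrix \<mu> = (\<chi> x y. \<mu> $ y)"

definition projection_chain ::
  "real ^ 'x \<Rightarrow> ('k \<Rightarrow> 'x set) \<Rightarrow> real ^ 'x ^ 'x \<Rightarrow> real ^ 'k ^ 'k" where
  "projection_chain \<mu> B P =
     (\<chi> i j. (\<Sum>x\<in>B i. \<Sum>y\<in>B j. \<mu> $ x * P $ x $ y) / mass \<mu> (B i))"

definition projection_measure :: "real ^ 'x \<Rightarrow> ('k \<Rightarrow> 'x set) \<Rightarrow> real ^ 'k" where
  "projection_measure \<mu> B = (\<chi> i. mass \<mu> (B i))"

text \<open>The conventions \<open>0 log (0/a) = 0\<close> and \<open>0 log 0 = 0\<close> below hold because \<open>ln 0 = 0\<close>.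
  The divergence is real-valued; it is the usual one only if \<open>A $ x $ y = 0\<close> whenever
  \<open>B $ x $ y = 0\<close> and \<open>\<mu> $ x > 0\<close>.\<close>

definition KL :: "real ^ 'x \<Rightarrow> real ^ 'x ^ 'x \<Rightarrow> real ^ 'x ^ 'x \<Rightarrow> real" where
  "KL \<mu> A B = (\<Sum>x\<in>UNIV. \<Sum>y\<in>UNIV. \<mu> $ x * A $ x $ y * ln (A $ x $ y / B $ x $ y))"

definition shannon_entropy :: "real ^ 'x \<Rightarrow> real" where
  "shannon_entropy \<mu> = - (\<Sum>x\<in>UNIV. \<mu> $ x * ln (\<mu> $ x))"

definition weighted_inner :: "real ^ 'x \<Rightarrow> real ^ 'x \<Rightarrow> real ^ 'x \<Rightarrow> real" where
  "weighted_inner \<mu> f g = (\<Sum>x\<in>UNIV. f $ x * g $ x * \<mu> $ x)"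

definition log_sobolev_functional :: "real ^ 'x \<Rightarrow> real ^ 'x \<Rightarrow> real" where
  "log_sobolev_functional \<mu> f =
     (\<Sum>x\<in>UNIV. \<bar>f $ x\<bar>\<^sup>2 * ln (\<bar>f $ x\<bar>\<^sup>2 / weighted_inner \<mu> f f) * \<mu> $ x)"

text \<open>\<open>Inf\<close> on the reals is the genuine infimum only for non-empty sets bounded below. Both hold
  when \<open>\<mu>\<close> is a positive probability on at least two states and \<open>Q\<close> is \<open>\<mu>\<close>-stationary: any \<open>f\<close> with
  \<open>\<bar>f\<bar>\<close> non-constant qualifies, and all quotients are non-negative.\<close>

definition log_sobolev_constant :: "real ^ 'x \<Rightarrow> real ^ 'x ^ 'x \<Rightarrow> real" where
  "log_sobolev_constant \<mu> Q =
     Inf {weighted_inner \<mu> ((mat 1 - Q) *v f) f / log_sobolev_functional \<mu> f | f.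
            log_sobolev_functional \<mu> f \<noteq> 0}"

end

theory Submission
  imports Defs
begin

text \<open>
  Every row of \<open>(PG)\<^sup>l\<close> has a density with respect to \<open>\<pi>\<close> which is constant on blocks; as a function
  of the block it is obtained from the one for \<open>l = 1\<close> by applying the projection chain \<open>l - 1\<close>
  times. The divergence is thus an average of entropies on the block space. One step of a reversible
  kernel \<open>K\<close> contracts entropy by \<open>1 - \<alpha>(K\<^sup>2)\<close>: averaging the refined convexity inequality
  \<open>s ln s \<ge> t ln t + (1 + ln t) (s - t) + (\<surd>s - \<surd>t)\<^sup>2\<close> over \<open>K\<close> with \<open>t = Kf\<close>, \<open>s = f\<close>, the
  quadratic term dominates the variance of \<open>\<surd>f\<close> under \<open>K\<close>, whose mean is the Dirichlet form of
  \<open>K\<^sup>2\<close> at \<open>\<surd>f\<close>. Finally, for \<open>l = 1\<close> the averaged entropy is a mutual information, hence at most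
  the entropy of the block measure.
\<close>

text \<open>For a density \<open>f\<close>, the relative entropy of \<open>f \<mu>\<close> with
  respect to \<open>\<mu>\<close>; points where \<open>f\<close> vanishes contribute 0.\<close>

definition density_entropy :: "real ^ 'x \<Rightarrow> real ^ 'x \<Rightarrow> real" where
  "density_entropy \<mu> f = (\<Sum>x\<in>UNIV. \<mu> $ x * (f $ x * ln (f $ x)))"

section \<open>Entropy contraction for reversible kernels\<close>

lemma ln_mult_ge:
  fixes s t :: real
  assumes "s \<ge> 0" "t > 0"
  shows "s * ln (s / t) \<ge> s - t"
proof (cases "s = 0")
  case False
  then have "ln (t / s) \<le> t / s - 1" using assms by (intro ln_le_minus_one) auto
  then have "s * ln (t / s) \<le> s * (t / s - 1)" using assms by (intro mult_left_mono) auto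
  moreover have "s * (t / s - 1) = t - s" using False by (simp add: field_simps)
  moreover have "ln (t / s) = - ln (s / t)" using False assms by (simp add: ln_div)
  ultimately show ?thesis by simp
qed (use assms in auto)

text \<open>\<open>ln_mult_ge\<close> at the square roots, multiplied by 2 sqrt s, gives s ln (s /
  t) \<ge> 2 s - 2 sqrt s sqrt t = (s - t) + (sqrt s - sqrt t)^2, which is the claim rearranged. At
  s = 0 both sides are 0.\<close>

lemma xlnx_refined_convexity:
  fixes s t :: real
  assumes "s \<ge> 0" "t > 0"
  shows "s * ln s \<ge> t * ln t + (1 + ln t) * (s - t) + (sqrt s - sqrt t)\<^sup>2"
proof (cases "s = 0")
  case False
  then have s: "s > 0" using assms by simp
  have "sqrt s * ln (sqrt s / sqrt t) \<ge> sqrt s - sqrt t"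
    using assms by (intro ln_mult_ge) auto
  then have "2 * sqrt s * (sqrt s * ln (sqrt s / sqrt t)) \<ge> 2 * sqrt s * (sqrt s - sqrt t)"
    using s by (intro mult_left_mono) auto
  moreover have "2 * sqrt s * (sqrt s * ln (sqrt s / sqrt t)) = s * (ln s - ln t)"
  proof -
    have "2 * sqrt s * (sqrt s * ln (sqrt s / sqrt t))
        = 2 * (sqrt s * sqrt s) * ln (sqrt s / sqrt t)"
      by (simp only: mult_ac)
    also have "\<dots> = s * (ln s - ln t)"
      using s assms by (simp add: ln_div ln_sqrt right_diff_distrib)
    finally show ?thesis .
  qed
  moreover have "2 * sqrt s * (sqrt s - sqrt t) = 2 * s - 2 * sqrt s * sqrt t"
    using s by (simp add: right_diff_distrib)
  ultimately have "s * (ln s - ln t) \<ge> 2 * s - 2 * sqrt s * sqrt t"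
    by simp
  moreover have "(sqrt s - sqrt t)\<^sup>2 = s + t - 2 * sqrt s * sqrt t"
    using s assms by (simp add: power2_diff)
  ultimately show ?thesis by (simp add: algebra_simps)
qed (use assms in \<open>auto simp: algebra_simps\<close>)

section \<open>Reversible kernels and the Dirichlet form of the square\<close>

lemma reversible_row_sum:
  assumes "K \<in> reversible_matrices \<mu>"
  shows "(\<Sum>y\<in>UNIV. K $ x $ y) = 1"
  using assms by (auto simp: reversible_matrices_def transition_matrix_def prob_vector_def)

lemma reversible_nonneg:
  assumes "K \<in> reversible_matrices \<mu>"
  shows "0 \<le> K $ x $ y"
  using assms by (auto simp: reversible_matrices_def transition_matrix_def prob_vector_def)

lemma reversible_sym:
  assumes "K \<in> reversible_matrices \<mu>"
  shows "\<mu> $ x * K $ x $ y = \<mu> $ y * K $ y $ x"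
  using assms by (auto simp: reversible_matrices_def)

lemma reversible_self_adjoint:
  assumes K: "K \<in> reversible_matrices \<mu>"
  shows "(\<Sum>x\<in>UNIV. \<mu> $ x * ((K *v f) $ x * g $ x)) = (\<Sum>x\<in>UNIV. \<mu> $ x * (f $ x * (K *v g) $ x))"
proof -
  have "(\<Sum>x\<in>UNIV. \<mu> $ x * ((K *v f) $ x * g $ x))
      = (\<Sum>x\<in>UNIV. \<Sum>y\<in>UNIV. (\<mu> $ x * K $ x $ y) * f $ y * g $ x)"
    by (simp add: matrix_vector_mult_def sum_distrib_left sum_distrib_right mult_ac)
  also have "\<dots> = (\<Sum>x\<in>UNIV. \<Sum>y\<in>UNIV. (\<mu> $ y * K $ y $ x) * f $ y * g $ x)"
    by (subst reversible_sym[OF K]) simp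
  also have "\<dots> = (\<Sum>y\<in>UNIV. \<Sum>x\<in>UNIV. (\<mu> $ y * K $ y $ x) * f $ y * g $ x)"
    by (rule sum.swap)
  also have "\<dots> = (\<Sum>x\<in>UNIV. \<mu> $ x * (f $ x * (K *v g) $ x))"
    by (simp add: matrix_vector_mult_def sum_distrib_left sum_distrib_right mult_ac)
  finally show ?thesis .
qed

lemma reversible_stationary:
  assumes K: "K \<in> reversible_matrices \<mu>"
  shows "(\<Sum>x\<in>UNIV. \<mu> $ x * (K *v f) $ x) = (\<Sum>x\<in>UNIV. \<mu> $ x * f $ x)"
proof -
  have "K *v 1 = 1"
    by (simp add: vec_eq_iff matrix_vector_mult_def reversible_row_sum[OF K])
  with reversible_self_adjoint[OF K, of f 1] show ?thesis by simp
qed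

text \<open>Self-adjointness moves one factor: <K^2 f, f> = <K f, K f>.\<close>

lemma dirichlet_form_square:
  assumes K: "K \<in> reversible_matrices \<mu>"
  shows "weighted_inner \<mu> ((mat 1 - K ** K) *v f) f
    = (\<Sum>x\<in>UNIV. \<mu> $ x * (f $ x)\<^sup>2) - (\<Sum>x\<in>UNIV. \<mu> $ x * ((K *v f) $ x)\<^sup>2)"
proof -
  have "weighted_inner \<mu> ((mat 1 - K ** K) *v f) f
     = (\<Sum>x\<in>UNIV. \<mu> $ x * (f $ x)\<^sup>2) - (\<Sum>x\<in>UNIV. \<mu> $ x * ((K *v (K *v f)) $ x * f $ x))"
    by (simp add: weighted_inner_def matrix_vector_mult_diff_rdistrib matrix_vector_mul_assoc
        power2_eq_square algebra_simps sum_subtractf)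
  then show ?thesis
    by (simp only: reversible_self_adjoint[OF K, of "K *v f" f] power2_eq_square)
qed

text \<open>The left side is the variance of \<open>f\<close> under row \<open>x\<close>; centring
  at \<open>c\<close> instead of the mean adds (mean - c)^2.\<close>

lemma kernel_variance_le:
  assumes K: "K \<in> reversible_matrices \<mu>"
  shows "(K *v (\<chi> y. (f $ y)\<^sup>2)) $ x - ((K *v f) $ x)\<^sup>2 \<le> (\<Sum>y\<in>UNIV. K $ x $ y * (f $ y - c)\<^sup>2)"
proof -
  have "(\<Sum>y\<in>UNIV. K $ x $ y * (f $ y - c)\<^sup>2)
     = (\<Sum>y\<in>UNIV. K $ x $ y * (f $ y)\<^sup>2) - 2 * c * (\<Sum>y\<in>UNIV. K $ x $ y * f $ y)
       + c\<^sup>2 * (\<Sum>y\<in>UNIV. K $ x $ y)"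
    by (simp add: power2_diff sum_distrib_left algebra_simps sum_subtractf sum.distrib)
  also have "\<dots> = (K *v (\<chi> y. (f $ y)\<^sup>2)) $ x - ((K *v f) $ x)\<^sup>2 + ((K *v f) $ x - c)\<^sup>2"
    by (simp add: reversible_row_sum[OF K] matrix_vector_mult_def power2_diff)
  finally show ?thesis by simp
qed

lemma dirichlet_form_square_nonneg:
  assumes K: "K \<in> reversible_matrices \<mu>" and \<mu>: "\<And>x. 0 \<le> \<mu> $ x"
  shows "0 \<le> weighted_inner \<mu> ((mat 1 - K ** K) *v f) f"
proof -
  have "((K *v f) $ x)\<^sup>2 \<le> (K *v (\<chi> y. (f $ y)\<^sup>2)) $ x" for x
  proof -
    have "(K *v f) $ x = (\<Sum>y\<in>UNIV. K $ x $ y * f $ y)"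
      by (simp add: matrix_vector_mult_def)
    then have "((K *v f) $ x)\<^sup>2 = (\<Sum>y\<in>UNIV. K $ x $ y * f $ y)\<^sup>2" by simp
    \<comment> \<open>Splitting the weight into two square roots makes the first Cauchy-Schwarz
      factor the row sum 1.\<close>
    also have "\<dots> = (\<Sum>y\<in>UNIV. sqrt (K $ x $ y) * (sqrt (K $ x $ y) * f $ y))\<^sup>2"
      by (simp add: reversible_nonneg[OF K] flip: mult.assoc)
    also have "\<dots> \<le> (\<Sum>y\<in>UNIV. (sqrt (K $ x $ y))\<^sup>2) * (\<Sum>y\<in>UNIV. (sqrt (K $ x $ y) * f $ y)\<^sup>2)"
      by (rule Cauchy_Schwarz_ineq_sum)
    also have "\<dots> = (K *v (\<chi> y. (f $ y)\<^sup>2)) $ x"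
      by (simp add: reversible_nonneg[OF K] reversible_row_sum[OF K] power_mult_distrib
          matrix_vector_mult_def)
    finally show ?thesis .
  qed
  then have "(\<Sum>x\<in>UNIV. \<mu> $ x * ((K *v f) $ x)\<^sup>2)
      \<le> (\<Sum>x\<in>UNIV. \<mu> $ x * (K *v (\<chi> y. (f $ y)\<^sup>2)) $ x)"
    by (intro sum_mono mult_left_mono \<mu>)
  also have "\<dots> = (\<Sum>x\<in>UNIV. \<mu> $ x * (f $ x)\<^sup>2)"
    by (simp add: reversible_stationary[OF K])
  finally show ?thesis by (simp add: dirichlet_form_square[OF K])
qed

section \<open>The log-Sobolev inequality\<close>

lemma log_sobolev_functional_nonneg:
  assumes \<mu>: "prob_vector \<mu>" and pos: "\<And>x. \<mu> $ x > 0"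
  shows "0 \<le> log_sobolev_functional \<mu> f"
proof (cases "f = 0")
  case True
  then show ?thesis by (simp add: log_sobolev_functional_def)
next
  case False
  define w where "w = weighted_inner \<mu> f f"
  obtain x0 where "f $ x0 \<noteq> 0" using False by (auto simp: vec_eq_iff)
  then have w: "w > 0"
    unfolding w_def weighted_inner_def using pos
    by (intro sum_pos2[of _ x0]) (auto simp: less_imp_le zero_less_mult_iff linorder_neq_iff)
  \<comment> \<open>The mean of the squares is \<open>w\<close>, so the linear lower bound of
    \<open>ln_mult_ge\<close> averages to 0.\<close>
  have "0 = (\<Sum>x\<in>UNIV. (\<bar>f $ x\<bar>\<^sup>2 - w) * \<mu> $ x)"
    using \<mu> by (simp add: w_def weighted_inner_def prob_vector_def power2_eq_square
        left_diff_distrib sum_subtractf flip: sum_distrib_left)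
  also have "\<dots> \<le> log_sobolev_functional \<mu> f"
    unfolding log_sobolev_functional_def w_def[symmetric] using w pos
    by (intro sum_mono mult_right_mono ln_mult_ge) (auto intro: less_imp_le)
  finally show ?thesis .
qed

text \<open>The infimum with its denominator cleared. Both forms being non-negative, the quotients
  are bounded below by 0, so \<open>Inf\<close> is a lower bound; when the functional is 0 the left
  side vanishes.\<close>

lemma log_sobolev_inequality:
  assumes K: "K \<in> reversible_matrices \<mu>" and \<mu>: "prob_vector \<mu>" and pos: "\<And>x. \<mu> $ x > 0"
  shows "log_sobolev_constant \<mu> (K ** K) * log_sobolev_functional \<mu> f
    \<le> weighted_inner \<mu> ((mat 1 - K ** K) *v f) f"
proof (cases "log_sobolev_functional \<mu> f = 0")
  case True
  then show ?thesis
    using dirichlet_form_square_nonneg[OF K] pos by (simp add: less_imp_le)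
next
  case False
  then have L: "log_sobolev_functional \<mu> f > 0"
    using log_sobolev_functional_nonneg[OF \<mu> pos, of f] by simp
  have "log_sobolev_constant \<mu> (K ** K)
      \<le> weighted_inner \<mu> ((mat 1 - K ** K) *v f) f / log_sobolev_functional \<mu> f"
    unfolding log_sobolev_constant_def
  proof (rule cInf_lower)
    show "bdd_below {weighted_inner \<mu> ((mat 1 - K ** K) *v f) f / log_sobolev_functional \<mu> f | f.
            log_sobolev_functional \<mu> f \<noteq> 0}"
      using dirichlet_form_square_nonneg[OF K] log_sobolev_functional_nonneg[OF \<mu> pos] pos
      by (intro bdd_belowI[of _ 0]) (auto simp: less_imp_le)
  qed (use False in auto)
  then show ?thesis using L by (simp add: field_simps)
qed

section \<open>Entropy decay in one step\<close>

lemma density_entropy_nonneg: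
  assumes \<mu>: "prob_vector \<mu>" and f: "\<And>x. f $ x \<ge> 0" "(\<Sum>x\<in>UNIV. \<mu> $ x * f $ x) = 1"
  shows "0 \<le> density_entropy \<mu> f"
proof -
  have "0 = (\<Sum>x\<in>UNIV. \<mu> $ x * (f $ x - 1))"
    using \<mu> f by (simp add: right_diff_distrib sum_subtractf prob_vector_def)
  also have "\<dots> \<le> density_entropy \<mu> f"
    unfolding density_entropy_def using \<mu> ln_mult_ge[OF f(1), of 1]
    by (intro sum_mono mult_left_mono) (auto simp: prob_vector_def)
  finally show ?thesis .
qed

lemma kernel_density:
  assumes K: "K \<in> reversible_matrices \<mu>"
    and f: "\<And>x. f $ x \<ge> 0" "(\<Sum>x\<in>UNIV. \<mu> $ x * f $ x) = 1"
  shows "(K *v f) $ x \<ge> 0" "(\<Sum>x\<in>UNIV. \<mu> $ x * (K *v f) $ x) = 1"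
  using f by (auto simp: matrix_vector_mult_def reversible_nonneg[OF K] intro!: sum_nonneg)
    (use reversible_stationary[OF K, of f] in \<open>simp add: matrix_vector_mult_def\<close>)

text \<open>\<open>xlnx_refined_convexity\<close> at t = (K f)(x) is averaged over row
  \<open>x\<close>. The linear term has mean 0, and the quadratic one dominates the variance of sqrt
  f, the bracket on the left.\<close>

lemma kernel_entropy_drop:
  assumes K: "K \<in> reversible_matrices \<mu>" and f: "\<And>x. f $ x \<ge> 0"
  shows "(K *v f) $ x * ln ((K *v f) $ x) + ((K *v f) $ x - ((K *v (\<chi> y. sqrt (f $ y))) $ x)\<^sup>2)
    \<le> (K *v (\<chi> y. f $ y * ln (f $ y))) $ x"
proof -
  define t where "t = (K *v f) $ x"
  have t: "t = (\<Sum>y\<in>UNIV. K $ x $ y * f $ y)" by (simp add: t_def matrix_vector_mult_def)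
  have "t \<ge> 0" unfolding t using reversible_nonneg[OF K] f by (intro sum_nonneg) simp
  then consider "t = 0" | "t > 0" by fastforce
  then show ?thesis
  proof cases
    \<comment> \<open>The convexity inequality excludes t = 0. Here every
      \<open>K $ x $ y * f $ y\<close> is 0, so the right side is 0 and the left side is minus a
      square.\<close>
    case 1
    then have "K $ x $ y * f $ y = 0" for y
      unfolding t using sum_nonneg_0[of UNIV "\<lambda>y. K $ x $ y * f $ y" y] reversible_nonneg[OF K] f
      by simp
    then have "K $ x $ y * (f $ y * ln (f $ y)) = 0" for y by (metis mult.assoc mult_zero_left)
    then have "(K *v (\<chi> y. f $ y * ln (f $ y))) $ x = 0"
      by (simp only: matrix_vector_mult_def vec_lambda_beta sum.neutral_const)
    then show ?thesis using 1 unfolding t_def by simp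
  next
    case 2
    have "(K *v f) $ x - ((K *v (\<chi> y. sqrt (f $ y))) $ x)\<^sup>2
        \<le> (\<Sum>y\<in>UNIV. K $ x $ y * (sqrt (f $ y) - sqrt t)\<^sup>2)"
      using kernel_variance_le[OF K, of "\<chi> y. sqrt (f $ y)" x "sqrt t"] f by simp
    \<comment> \<open>Row sums equal to 1 are inserted so that all terms merge into a single sum
      over the row.\<close>
    then have "t * ln t + ((K *v f) $ x - ((K *v (\<chi> y. sqrt (f $ y))) $ x)\<^sup>2)
       \<le> t * ln t * (\<Sum>y\<in>UNIV. K $ x $ y) + (1 + ln t) * (t - t * (\<Sum>y\<in>UNIV. K $ x $ y))
        + (\<Sum>y\<in>UNIV. K $ x $ y * (sqrt (f $ y) - sqrt t)\<^sup>2)"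
      by (simp add: reversible_row_sum[OF K])
    also have "\<dots> = (\<Sum>y\<in>UNIV. K $ x $ y *
        (t * ln t + (1 + ln t) * (f $ y - t) + (sqrt (f $ y) - sqrt t)\<^sup>2))"
      by (subst (3) t) (simp add: sum_distrib_left sum.distrib sum_subtractf algebra_simps)
    also have "\<dots> \<le> (\<Sum>y\<in>UNIV. K $ x $ y * (f $ y * ln (f $ y)))"
      using xlnx_refined_convexity[OF f 2] reversible_nonneg[OF K]
      by (intro sum_mono mult_left_mono) auto
    finally show ?thesis by (simp add: matrix_vector_mult_def t)
  qed
qed

lemma entropy_contraction:
  assumes K: "K \<in> reversible_matrices \<mu>" and \<mu>: "prob_vector \<mu>" and pos: "\<And>x. \<mu> $ x > 0"
    and f: "\<And>x. f $ x \<ge> 0" "(\<Sum>x\<in>UNIV. \<mu> $ x * f $ x) = 1"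
  shows "density_entropy \<mu> (K *v f) \<le> (1 - log_sobolev_constant \<mu> (K ** K)) * density_entropy \<mu> f"
proof -
  define h where "h = (\<chi> y. sqrt (f $ y))"
  have h: "(h $ x)\<^sup>2 = f $ x" for x using f by (simp add: h_def)
  \<comment> \<open>With norm 1 the normalisation inside the logarithm disappears, so the functional
    at \<open>h\<close> is the entropy of \<open>f\<close>.\<close>
  have "weighted_inner \<mu> h h = 1"
    using f(2) by (simp add: weighted_inner_def mult.commute h flip: power2_eq_square)
  then have ent: "log_sobolev_functional \<mu> h = density_entropy \<mu> f"
    by (simp add: log_sobolev_functional_def density_entropy_def h mult_ac)
  \<comment> \<open>The Dirichlet form is the mean of f - (K h)^2; stationarity lets K f replace f,
    as the pointwise bound requires.\<close>
  have "density_entropy \<mu> (K *v f) + weighted_inner \<mu> ((mat 1 - K ** K) *v h) h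
      = (\<Sum>x\<in>UNIV. \<mu> $ x * ((K *v f) $ x * ln ((K *v f) $ x) + ((K *v f) $ x - ((K *v h) $ x)\<^sup>2)))"
    by (simp add: dirichlet_form_square[OF K] h density_entropy_def distrib_left right_diff_distrib
        sum.distrib sum_subtractf reversible_stationary[OF K])
  also have "\<dots> \<le> (\<Sum>x\<in>UNIV. \<mu> $ x * (K *v (\<chi> y. f $ y * ln (f $ y))) $ x)"
    unfolding h_def using kernel_entropy_drop[OF K f(1)] pos
    by (intro sum_mono mult_left_mono) (auto intro: less_imp_le)
  also have "\<dots> = density_entropy \<mu> f"
    by (simp add: reversible_stationary[OF K] density_entropy_def)
  finally show ?thesis
    using log_sobolev_inequality[OF K \<mu> pos, of h] by (simp add: ent algebra_simps)
qed

text \<open>Makes the contraction factor non-negative, so that the contraction can be iterated.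
  Contracting a density of positive entropy leaves a non-negative entropy, which forces the sign of
  the factor.\<close>

lemma log_sobolev_constant_square_le_1:
  fixes \<mu> :: "real ^ 'k"
  assumes K: "K \<in> reversible_matrices \<mu>" and \<mu>: "prob_vector \<mu>" and pos: "\<And>x. \<mu> $ x > 0"
    and card: "CARD('k) \<ge> 2"
  shows "log_sobolev_constant \<mu> (K ** K) \<le> 1"
proof -
  fix j :: 'k
  obtain i where i: "i \<noteq> j"
    using card by (metis (full_types) UNIV_eq_I card_1_singleton_iff insertI1 is_singletonI
        is_singleton_altdef not_less_eq_eq numeral_2_eq_2 le_refl One_nat_def)
  have "\<mu> $ i + \<mu> $ j = sum (($) \<mu>) {i, j}" using i by simp
  also have "\<dots> \<le> (\<Sum>x\<in>UNIV. \<mu> $ x)" using pos by (intro sum_mono2) (auto intro: less_imp_le)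
  finally have "\<mu> $ j < 1" using \<mu> pos[of i] by (simp add: prob_vector_def)
  \<comment> \<open>The density of a point mass at \<open>j\<close>: its entropy - ln
    (\<open>\<mu> $ j\<close>) is positive because the second state \<open>i\<close> keeps
    \<open>\<mu> $ j\<close> below 1.\<close>
  define f where "f = (\<chi> x. if x = j then 1 / \<mu> $ j else 0)"
  have f: "f $ x \<ge> 0" "(\<Sum>x\<in>UNIV. \<mu> $ x * f $ x) = 1" for x
    using pos[of j] by (auto simp: f_def if_distrib cong: if_cong)
  have "\<mu> $ x * (f $ x * ln (f $ x)) = (if x = j then - ln (\<mu> $ j) else 0)" for x
    using pos[of j] by (auto simp: f_def ln_div)
  then have "density_entropy \<mu> f = - ln (\<mu> $ j)"
    by (simp add: density_entropy_def)
  then have "density_entropy \<mu> f > 0" using \<open>\<mu> $ j < 1\<close> pos[of j] by simp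
  moreover have "0 \<le> (1 - log_sobolev_constant \<mu> (K ** K)) * density_entropy \<mu> f"
    using density_entropy_nonneg[OF \<mu> kernel_density[OF K f]] entropy_contraction[OF K \<mu> pos f]
    by linarith
  ultimately show ?thesis by (simp add: zero_le_mult_iff)
qed

section \<open>Reduction to the projection chain\<close>

definition block_index :: "('k \<Rightarrow> 'x set) \<Rightarrow> 'x \<Rightarrow> 'k" where
  "block_index B x = (THE i. x \<in> B i)"

lemma block_index_eq_iff:
  assumes "is_partition B"
  shows "x \<in> B i \<longleftrightarrow> block_index B x = i"
proof -
  have ex1: "\<exists>!i. x \<in> B i"
    using assms by (auto simp: is_partition_def disjoint_family_on_def)
  from theI'[OF ex1] ex1 show ?thesis by (auto simp: block_index_def)
qed

text \<open>Blocks are the fibres of \<open>block_index\<close>. Taking \<open>g\<close> constantly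
  1 splits a full sum into block sums.\<close>

lemma sum_over_blocks:
  fixes B :: "'k::finite \<Rightarrow> 'x::finite set" and g :: "'k \<Rightarrow> real"
  assumes "is_partition B"
  shows "(\<Sum>y\<in>UNIV. h y * g (block_index B y)) = (\<Sum>i\<in>UNIV. (\<Sum>y\<in>B i. h y) * g i)"
proof -
  have B: "B i = {y \<in> UNIV. block_index B y = i}" for i
    using block_index_eq_iff[OF assms] by auto
  have "(\<Sum>y\<in>UNIV. h y * g (block_index B y))
      = (\<Sum>i\<in>UNIV. \<Sum>y | y \<in> UNIV \<and> block_index B y = i. h y * g (block_index B y))"
    by (rule sum.group[symmetric]) auto
  also have "\<dots> = (\<Sum>i\<in>UNIV. (\<Sum>y\<in>B i. h y) * g i)"
    by (simp add: B sum_distrib_right)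
  finally show ?thesis .
qed

lemma mass_block_pos:
  fixes \<pi> :: "real ^ 'x"
  assumes "is_partition B" "\<And>x. \<pi> $ x > 0"
  shows "mass \<pi> (B i) > 0"
  using assms unfolding mass_def is_partition_def by (intro sum_pos) auto

lemma prob_vector_projection_measure:
  fixes \<pi> :: "real ^ 'x" and B :: "'k::finite \<Rightarrow> 'x set"
  assumes "prob_vector \<pi>" "is_partition B"
  shows "prob_vector (projection_measure \<pi> B)"
  using sum_over_blocks[OF assms(2), of "($) \<pi>" "\<lambda>_. 1"] assms(1)
  by (auto simp: prob_vector_def projection_measure_def mass_def intro!: sum_nonneg)

lemma projection_chain_flow:
  fixes \<pi> :: "real ^ 'x" and B :: "'k::finite \<Rightarrow> 'x set"
  assumes "is_partition B" "\<And>x. \<pi> $ x > 0"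
  shows "mass \<pi> (B i) * projection_chain \<pi> B P $ i $ j
    = (\<Sum>x\<in>B i. \<Sum>y\<in>B j. \<pi> $ x * P $ x $ y)"
  using mass_block_pos[OF assms, of i] by (simp add: projection_chain_def)

text \<open>Everything is checked on the flows between blocks: those leaving a block add up to its
  mass, and detailed balance of \<open>P\<close> makes them symmetric.\<close>

lemma projection_chain_reversible:
  fixes \<pi> :: "real ^ 'x" and B :: "'k::finite \<Rightarrow> 'x set"
  assumes pos: "\<And>x. \<pi> $ x > 0" and P: "P \<in> reversible_matrices \<pi>" and B: "is_partition B"
  shows "projection_chain \<pi> B P \<in> reversible_matrices (projection_measure \<pi> B)"
proof -
  have nonneg: "projection_chain \<pi> B P $ i $ j \<ge> 0" for i j
    using reversible_nonneg[OF P] pos mass_block_pos[OF B pos, of i]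
    by (auto simp: projection_chain_def intro!: divide_nonneg_pos sum_nonneg mult_nonneg_nonneg
        intro: less_imp_le)
  have "mass \<pi> (B i) * (\<Sum>j\<in>UNIV. projection_chain \<pi> B P $ i $ j) = mass \<pi> (B i)" for i
  proof -
    have "mass \<pi> (B i) * (\<Sum>j\<in>UNIV. projection_chain \<pi> B P $ i $ j)
        = (\<Sum>j\<in>UNIV. \<Sum>x\<in>B i. \<Sum>y\<in>B j. \<pi> $ x * P $ x $ y)"
      by (simp add: sum_distrib_left projection_chain_flow[OF B pos])
    also have "\<dots> = (\<Sum>x\<in>B i. \<Sum>j\<in>UNIV. \<Sum>y\<in>B j. \<pi> $ x * P $ x $ y)"
      by (rule sum.swap)
    also have "\<dots> = (\<Sum>x\<in>B i. \<Sum>y\<in>UNIV. \<pi> $ x * P $ x $ y)"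
      using sum_over_blocks[OF B, of "\<lambda>y. \<pi> $ x * P $ x $ y" "\<lambda>_. 1" for x] by simp
    also have "\<dots> = mass \<pi> (B i)"
      by (simp add: mass_def reversible_row_sum[OF P] flip: sum_distrib_left)
    finally show ?thesis .
  qed
  then have row: "(\<Sum>j\<in>UNIV. projection_chain \<pi> B P $ i $ j) = 1" for i
    using mass_block_pos[OF B pos, of i] by (metis less_irrefl mult_cancel_left1)
  have "(\<Sum>x\<in>B i. \<Sum>y\<in>B j. \<pi> $ x * P $ x $ y) = (\<Sum>x\<in>B j. \<Sum>y\<in>B i. \<pi> $ x * P $ x $ y)" for i j
    by (subst sum.swap) (simp add: reversible_sym[OF P])
  then show ?thesis
    using nonneg row
    by (simp add: reversible_matrices_def transition_matrix_def prob_vector_def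
        projection_measure_def projection_chain_flow[OF B pos])
qed

section \<open>Powers of PG in terms of block densities\<close>

text \<open>The law of the block reached by one step of \<open>P\<close> from \<open>x\<close>, as a
  density with respect to the block measure.\<close>

definition block_density :: "real ^ 'x \<Rightarrow> ('k \<Rightarrow> 'x set) \<Rightarrow> real ^ 'x ^ 'x \<Rightarrow> 'x \<Rightarrow> real ^ 'k" where
  "block_density \<pi> B P x = (\<chi> j. (\<Sum>y\<in>B j. P $ x $ y) / mass \<pi> (B j))"

lemma block_density_nonneg:
  fixes \<pi> :: "real ^ 'x" and B :: "'k::finite \<Rightarrow> 'x set"
  assumes pos: "\<And>x. \<pi> $ x > 0" and P: "P \<in> reversible_matrices \<pi>" and B: "is_partition B"
  shows "block_density \<pi> B P x $ i \<ge> 0"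
  using reversible_nonneg[OF P] mass_block_pos[OF B pos, of i]
  by (auto simp: block_density_def intro!: divide_nonneg_pos sum_nonneg)

lemma block_density_sum:
  fixes \<pi> :: "real ^ 'x" and B :: "'k::finite \<Rightarrow> 'x set"
  assumes pos: "\<And>x. \<pi> $ x > 0" and P: "P \<in> reversible_matrices \<pi>" and B: "is_partition B"
  shows "(\<Sum>i\<in>UNIV. projection_measure \<pi> B $ i * block_density \<pi> B P x $ i) = 1"
proof -
  have "projection_measure \<pi> B $ i * block_density \<pi> B P x $ i = (\<Sum>y\<in>B i. P $ x $ y)" for i
    using mass_block_pos[OF B pos, of i] by (simp add: projection_measure_def block_density_def)
  then show ?thesis
    using sum_over_blocks[OF B, of "($) (P $ x)" "\<lambda>_. 1"] reversible_row_sum[OF P, of x] by simp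
qed

text \<open>The Gibbs step resamples from \<open>\<pi>\<close> within the block reached, so beyond
  the factor \<open>\<pi> $ y\<close> only the label of \<open>y\<close> matters.\<close>

lemma mult_gibbs_kernel_entry:
  fixes \<pi> :: "real ^ 'x" and B :: "'k::finite \<Rightarrow> 'x set"
  assumes B: "is_partition B"
  shows "(P ** gibbs_kernel \<pi> B) $ x $ y = \<pi> $ y * block_density \<pi> B P x $ block_index B y"
proof -
  have G: "gibbs_kernel \<pi> B $ z $ y
      = (if z \<in> B (block_index B y) then \<pi> $ y / mass \<pi> (B (block_index B y)) else 0)" for z
    using block_index_eq_iff[OF B]
    by (auto simp: gibbs_kernel_def block_def simp flip: block_index_def)
  have "(P ** gibbs_kernel \<pi> B) $ x $ y
      = (\<Sum>z\<in>B (block_index B y). P $ x $ z * (\<pi> $ y / mass \<pi> (B (block_index B y))))"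
    by (simp add: matrix_matrix_mult_def G if_distrib sum.If_cases cong: if_cong)
  then show ?thesis by (simp add: block_density_def sum_distrib_left sum_divide_distrib mult_ac)
qed

lemma matrix_power_Suc_right: "matrix_power A (Suc n) = matrix_power A n ** A"
  by (induction n) (auto simp: matrix_mul_assoc)

text \<open>The first factor PG produces the block density of \<open>x\<close>; each of the other
  \<open>n\<close> factors, appended on the right, applies the projection chain once.\<close>

lemma matrix_power_gibbs_entry:
  fixes \<pi> :: "real ^ 'x" and B :: "'k::finite \<Rightarrow> 'x set"
  assumes pos: "\<And>x. \<pi> $ x > 0" and P: "P \<in> reversible_matrices \<pi>" and B: "is_partition B"
  shows "matrix_power (P ** gibbs_kernel \<pi> B) (Suc n) $ x $ y
    = \<pi> $ y * (((*v) (projection_chain \<pi> B P) ^^ n) (block_density \<pi> B P x)) $ block_index B y"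
proof (induction n arbitrary: y)
  case 0
  then show ?case by (simp add: mult_gibbs_kernel_entry[OF B])
next
  case (Suc n)
  define f where "f = ((*v) (projection_chain \<pi> B P) ^^ n) (block_density \<pi> B P x)"
  define j where "j = block_index B y"
  let ?m = "\<lambda>i. mass \<pi> (B i)"
  \<comment> \<open>The flow from block i to block j is divided by the mass of j. Reversibility
    identifies this with the entry (j, i), so densities evolve under the chain itself, not its
    transpose.\<close>
  have flow: "(\<Sum>z\<in>B i. \<pi> $ z * block_density \<pi> B P z $ j) = projection_chain \<pi> B P $ j $ i" for i
  proof -
    have "(\<Sum>z\<in>B i. \<pi> $ z * block_density \<pi> B P z $ j)
        = (\<Sum>z\<in>B i. \<Sum>w\<in>B j. \<pi> $ z * P $ z $ w) / ?m j"
      by (simp add: block_density_def sum_distrib_left sum_divide_distrib)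
    also have "\<dots> = ?m i * projection_chain \<pi> B P $ i $ j / ?m j"
      by (simp add: projection_chain_flow[OF B pos])
    also have "\<dots> = projection_chain \<pi> B P $ j $ i"
      using reversible_sym[OF projection_chain_reversible[OF pos P B], of i j]
        mass_block_pos[OF B pos, of j] by (simp add: projection_measure_def)
    finally show ?thesis .
  qed
  have "matrix_power (P ** gibbs_kernel \<pi> B) (Suc (Suc n)) $ x $ y
      = (\<Sum>z\<in>UNIV. matrix_power (P ** gibbs_kernel \<pi> B) (Suc n) $ x $ z
          * (P ** gibbs_kernel \<pi> B) $ z $ y)"
    by (subst matrix_power_Suc_right) (simp only: matrix_matrix_mult_def vec_lambda_beta)
  also have "\<dots> = (\<Sum>z\<in>UNIV. (\<pi> $ y * (\<pi> $ z * block_density \<pi> B P z $ j)) * f $ block_index B z)"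
    by (simp only: Suc.IH mult_gibbs_kernel_entry[OF B] f_def[symmetric] j_def mult_ac)
  also have "\<dots> = (\<Sum>i\<in>UNIV. (\<pi> $ y * projection_chain \<pi> B P $ j $ i) * f $ i)"
    by (simp only: sum_over_blocks[OF B, of _ "($) f"] sum_distrib_left[symmetric] flow)
  also have "\<dots> = \<pi> $ y * (projection_chain \<pi> B P *v f) $ j"
    by (simp add: matrix_vector_mult_def sum_distrib_left mult_ac)
  finally show ?case by (simp add: f_def j_def)
qed

section \<open>Divergence as an averaged block entropy\<close>

lemma KL_blockwise_density:
  fixes \<pi> :: "real ^ 'x" and B :: "'k::finite \<Rightarrow> 'x set"
  assumes pos: "\<And>x. \<pi> $ x > 0" and B: "is_partition B"
    and A: "\<And>x y. A $ x $ y = \<pi> $ y * f x $ block_index B y"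
  shows "KL \<pi> A (stationary_matrix \<pi>)
    = (\<Sum>x\<in>UNIV. \<pi> $ x * density_entropy (projection_measure \<pi> B) (f x))"
proof -
  have "A $ x $ y / \<pi> $ y = f x $ block_index B y" for x y
    using A pos[of y] by simp
  then have "(\<Sum>y\<in>UNIV. \<pi> $ x * A $ x $ y * ln (A $ x $ y / stationary_matrix \<pi> $ x $ y))
      = \<pi> $ x * (\<Sum>y\<in>UNIV. \<pi> $ y * (f x $ block_index B y * ln (f x $ block_index B y)))" for x
    by (simp add: stationary_matrix_def A sum_distrib_left mult_ac)
  also have "\<dots> x = \<pi> $ x * density_entropy (projection_measure \<pi> B) (f x)" for x
    by (simp add: sum_over_blocks[OF B, of _ "\<lambda>i. f x $ i * ln (f x $ i)"]
        density_entropy_def projection_measure_def mass_def)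
  finally show ?thesis by (simp add: KL_def)
qed

text \<open>The left side is the mutual information of the stationary starting point and the block
  after one \<open>P\<close>-step. Discarding the non-negative conditional entropy leaves the
  entropy of the block.\<close>

lemma block_density_entropy_le:
  fixes \<pi> :: "real ^ 'x" and B :: "'k::finite \<Rightarrow> 'x set"
  assumes pos: "\<And>x. \<pi> $ x > 0" and P: "P \<in> reversible_matrices \<pi>" and B: "is_partition B"
  shows "(\<Sum>x\<in>UNIV. \<pi> $ x * density_entropy (projection_measure \<pi> B) (block_density \<pi> B P x))
    \<le> shannon_entropy (projection_measure \<pi> B)"
proof -
  define q where "q x j = (\<Sum>y\<in>B j. P $ x $ y)" for x j
  let ?m = "\<lambda>j. mass \<pi> (B j)"
  have q0: "q x j \<ge> 0" for x j
    unfolding q_def using reversible_nonneg[OF P] by (intro sum_nonneg)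
  have q1: "q x j \<le> 1" for x j
    unfolding q_def reversible_row_sum[OF P, of x, symmetric] using reversible_nonneg[OF P]
    by (intro sum_mono2) auto
  \<comment> \<open>The mass cancels, leaving q ln q - q ln m, where q ln q \<le> 0 since q is a
    probability.\<close>
  have "?m j * (q x j / ?m j * ln (q x j / ?m j)) \<le> - (q x j * ln (?m j))" for x j
  proof (cases "q x j = 0")
    case False
    then have "q x j > 0" using q0[of x j] by simp
    moreover from this have "q x j * ln (q x j) \<le> 0"
      using q1[of x j] by (simp add: mult_nonneg_nonpos)
    ultimately show ?thesis
      using mass_block_pos[OF B pos, of j] by (simp add: ln_div right_diff_distrib)
  qed simp
  then have "density_entropy (projection_measure \<pi> B) (block_density \<pi> B P x)
      \<le> (\<Sum>j\<in>UNIV. - (q x j * ln (?m j)))" for x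
    by (simp only: density_entropy_def projection_measure_def block_density_def vec_lambda_beta
        flip: q_def) (intro sum_mono, simp)
  then have "(\<Sum>x\<in>UNIV. \<pi> $ x * density_entropy (projection_measure \<pi> B) (block_density \<pi> B P x))
      \<le> (\<Sum>x\<in>UNIV. \<pi> $ x * (\<Sum>j\<in>UNIV. - (q x j * ln (?m j))))"
    using pos by (intro sum_mono mult_left_mono) (auto intro: less_imp_le)
  also have "\<dots> = (\<Sum>x\<in>UNIV. \<Sum>j\<in>UNIV. \<pi> $ x * q x j * - ln (?m j))"
    by (simp add: sum_distrib_left mult_ac)
  also have "\<dots> = (\<Sum>j\<in>UNIV. \<Sum>x\<in>UNIV. \<pi> $ x * q x j * - ln (?m j))"
    by (rule sum.swap)
  also have "\<dots> = (\<Sum>j\<in>UNIV. (\<Sum>x\<in>UNIV. \<pi> $ x * q x j) * - ln (?m j))"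
    by (simp only: sum_distrib_right)
  also have "\<dots> = shannon_entropy (projection_measure \<pi> B)"
  proof -
    \<comment> \<open>Stationarity of \<open>\<pi>\<close> applied to the indicator of block
      \<open>j\<close>.\<close>
    have "(\<Sum>x\<in>UNIV. \<pi> $ x * q x j) = ?m j" for j
    proof -
      have "q x j = (P *v (\<chi> y. if y \<in> B j then 1 else 0)) $ x" for x
        by (simp add: q_def matrix_vector_mult_def if_distrib sum.If_cases cong: if_cong)
      then show ?thesis
        by (simp add: reversible_stationary[OF P] mass_def if_distrib sum.If_cases cong: if_cong)
    qed
    then show ?thesis by (simp add: shannon_entropy_def projection_measure_def sum_negf)
  qed
  finally show ?thesis .
qed

section \<open>Iteration of the contraction and averaging over starting points\<close>

theorem corollary3p6:
  fixes \<pi> :: "real ^ 'x" and P :: "real ^ 'x ^ 'x" and B :: "'k::finite \<Rightarrow> 'x set" and l :: nat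
  assumes "prob_vector \<pi>" and "\<And>x. \<pi> $ x > 0"
    and "P \<in> reversible_matrices \<pi>"
    and "is_partition B" and "CARD('k) \<ge> 2"
    and "l \<ge> 2"
  shows "KL \<pi> (matrix_power (P ** gibbs_kernel \<pi> B) l) (stationary_matrix \<pi>)
    \<le> (1 - log_sobolev_constant (projection_measure \<pi> B)
              (projection_chain \<pi> B P ** projection_chain \<pi> B P)) ^ (l - 1)
       * shannon_entropy (projection_measure \<pi> B)"
proof -
  note pos = assms(2) and P = assms(3) and B = assms(4)
  define K where "K = projection_chain \<pi> B P"
  define \<mu> where "\<mu> = projection_measure \<pi> B"
  define f where "f n x = (((*v) K) ^^ n) (block_density \<pi> B P x)" for n x
  define c where "c = 1 - log_sobolev_constant \<mu> (K ** K)"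
  have K: "K \<in> reversible_matrices \<mu>"
    unfolding K_def \<mu>_def by (rule projection_chain_reversible[OF pos P B])
  have \<mu>: "prob_vector \<mu>"
    unfolding \<mu>_def by (rule prob_vector_projection_measure[OF assms(1) B])
  have \<mu>_pos: "\<mu> $ i > 0" for i
    using mass_block_pos[OF B pos] by (simp add: \<mu>_def projection_measure_def)
  have c: "c \<ge> 0"
    unfolding c_def using log_sobolev_constant_square_le_1[OF K \<mu> \<mu>_pos assms(5)] by simp
  have density: "(\<forall>i. f n x $ i \<ge> 0) \<and> (\<Sum>i\<in>UNIV. \<mu> $ i * f n x $ i) = 1" for n x
  proof (induction n)
    case 0
    then show ?case
      using block_density_nonneg[OF pos P B] block_density_sum[OF pos P B] by (simp add: f_def \<mu>_def)
  next
    case (Suc n)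
    then show ?case using kernel_density[OF K, of "f n x"] by (simp add: f_def)
  qed
  have ent: "density_entropy \<mu> (f n x) \<le> c ^ n * density_entropy \<mu> (f 0 x)" for n x
  proof (induction n)
    case (Suc n)
    have "density_entropy \<mu> (f (Suc n) x) \<le> c * density_entropy \<mu> (f n x)"
      using entropy_contraction[OF K \<mu> \<mu>_pos, of "f n x"] density[of n x] by (simp add: f_def c_def)
    also have "\<dots> \<le> c * (c ^ n * density_entropy \<mu> (f 0 x))"
      using Suc c by (rule mult_left_mono)
    finally show ?case by simp
  qed simp
  \<comment> \<open>Here n = l - 1: one factor PG is spent on the initial density, the other
    \<open>n\<close> contract.\<close>
  obtain n where l: "l = Suc n" using assms(6) by (cases l) auto
  have "KL \<pi> (matrix_power (P ** gibbs_kernel \<pi> B) l) (stationary_matrix \<pi>)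
      = (\<Sum>x\<in>UNIV. \<pi> $ x * density_entropy \<mu> (f n x))"
    unfolding l \<mu>_def f_def K_def
    by (rule KL_blockwise_density[OF pos B matrix_power_gibbs_entry[OF pos P B]])
  also have "\<dots> \<le> (\<Sum>x\<in>UNIV. \<pi> $ x * (c ^ n * density_entropy \<mu> (f 0 x)))"
    using pos ent by (intro sum_mono mult_left_mono) (auto intro: less_imp_le)
  also have "\<dots> = c ^ n * (\<Sum>x\<in>UNIV. \<pi> $ x * density_entropy \<mu> (f 0 x))"
    by (simp add: sum_distrib_left mult_ac)
  \<comment> \<open>The entropy bound concerns the average over starting points, hence it is applied
    after summation.\<close>
  also have "\<dots> \<le> c ^ n * shannon_entropy \<mu>"
    using block_density_entropy_le[OF pos P B] c by (intro mult_left_mono) (auto simp: f_def \<mu>_def)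
  finally show ?thesis by (simp add: l c_def K_def \<mu>_def)
qed

end
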